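(* Suppose $x\in\Omega$ and $v\in\mathbb{B}^m$. Then $$B_{k,\Omega\times\mathbb{B}^m}[f](x,v)=\int_{\Omega}\int_{\mathbb{B}^m}R_{k,\Omega\times\mathbb{B}^m}(y,x,u,v)f(y,u)\,du\,dy$$ for all $f\in L^2(\Omega\times\mathbb{B}^m,\mathbb{C})$.
   Context: Let $m\geq 3$, $k\geq 1$ be integers, $\Omega\subset\mathbb{R}^m$ a bounded open domain, $\mathbb{B}^m$ the open unit ball of $\mathbb{R}^m$, and $\mathcal{H}_k(\mathbb{C})$ the space of complex-valued homogeneous harmonic polynomials of degree $k$ on $\mathbb{R}^m$. A function $f(x,u)$ is $\mathcal{H}_k(\mathbb{C})$-valued if $f(x,\cdot)\in\mathcal{H}_k(\mathbb{C})$ for each fixed $x$. The bosonic Laplacian on such functions is $$\mathcal{D}_k=\Delta_x-\frac{4\langle u,\nabla_x\rangle\langle\nabla_u,\nabla_x\rangle}{m+2k-2}+\frac{4|u|^2\langle\nabla_u,\nabla_x\rangle^2}{(m+2k-2)(m+2k-4)}.$$ The bosonic Bergman space $b^2(\Omega\times\mathbb{B}^m,\mathcal{H}_k(\mathbb{C}))$ is the set of $\mathcal{H}_k(\mathbb{C})$-valued functions $f\in L^2\cap C^2$ on $\Omega\times\mathbb{B}^m$ with $\mathcal{D}_kf=0$ in $\Omega\times\mathbb{B}^m$. It is a Hilbert space (a closed subspace of $L^2(\Omega\times\mathbb{B}^m,\mathbb{C})$) with inner product $\langle f,g\rangle_{b^2}=\int_{\Omega}\int_{\mathbb{B}^m}\overline{f(x,u)}g(x,u)\,du\,dx$,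 on which point evaluations are bounded. Its reproducing kernel $R_{k,\Omega\times\mathbb{B}^m}$ is the function such that for each $(x,v)\in\Omega\times\mathbb{B}^m$, $R_{k,\Omega\times\mathbb{B}^m}(\cdot,x,\cdot,v)$ is the unique element of $b^2(\Omega\times\mathbb{B}^m,\mathcal{H}_k(\mathbb{C}))$ with $f(x,v)=\int_{\Omega}\int_{\mathbb{B}^m}\overline{R_{k,\Omega\times\mathbb{B}^m}(y,x,u,v)}f(y,u)\,du\,dy$ for all $f\in b^2(\Omega\times\mathbb{B}^m,\mathcal{H}_k(\mathbb{C}))$. The bosonic Bergman projection $B_{k,\Omega\times\mathbb{B}^m}$ is the orthogonal projection of $L^2(\Omega\times\mathbb{B}^m,\mathbb{C})$ onto $b^2(\Omega\times\mathbb{B}^m,\mathcal{H}_k(\mathbb{C}))$. *)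

theory Defs
  imports "HOL-Analysis.Analysis"
begin

section \<open>Partial derivatives and smoothness classes\<close>

text \<open>
  Derivative along a line, rather than the total derivative applied to a vector. For
  \<open>f(x,u)\<close> of class \<open>C\<^sup>2\<close> and polynomial in \<open>u\<close>, a mixed derivative with two \<open>x\<close>-derivatives
  is in general only continuous in \<open>x\<close>, hence not totally differentiable, although it can
  still be differentiated in the directions of \<open>u\<close>. The last term of the bosonic
  Laplacian needs this.
\<close>

definition pd :: "'a::real_normed_vector \<Rightarrow> ('a \<Rightarrow> 'b::real_normed_vector) \<Rightarrow> 'a \<Rightarrow> 'b" where
  "pd w f z = vector_derivative (\<lambda>t::real. f (z + t *\<^sub>R w)) (at 0)"

text \<open>Intended for open \<open>S\<close>.\<close>

fun Ck_on :: "nat \<Rightarrow> ('a::euclidean_space \<Rightarrow> 'b::real_normed_vector) \<Rightarrow> 'a set \<Rightarrow> bool" where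
  "Ck_on 0 f S \<longleftrightarrow> continuous_on S f"
| "Ck_on (Suc n) f S \<longleftrightarrow> f differentiable_on S \<and> (\<forall>i\<in>Basis. Ck_on n (pd i f) S)"

section \<open>Homogeneous harmonic polynomials\<close>

definition laplacian :: "('a::euclidean_space \<Rightarrow> 'b::real_normed_vector) \<Rightarrow> 'a \<Rightarrow> 'b" where
  "laplacian p u = (\<Sum>i\<in>Basis. pd i (pd i p) u)"

definition homogeneous_harmonic :: "nat \<Rightarrow> (real^'m \<Rightarrow> complex) set" where
  "homogeneous_harmonic k =
    {p. polynomial_function p \<and> (\<forall>t u. p (t *\<^sub>R u) = t ^ k *\<^sub>R p u) \<and> (\<forall>u. laplacian p u = 0)}"

section \<open>The bosonic Laplacian\<close>

text \<open>
  A function \<open>f(x,u)\<close> of two vector variables is a function on the product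
  space; \<open>dx i\<close> and \<open>du i\<close> are its partial derivatives in the \<open>i\<close>-th coordinate of \<open>x\<close> and \<open>u\<close>.
\<close>

definition dx :: "'m::finite \<Rightarrow> ((real^'m) \<times> (real^'m) \<Rightarrow> complex) \<Rightarrow> (real^'m) \<times> (real^'m) \<Rightarrow> complex" where
  "dx i = pd (axis i 1, 0)"

definition du :: "'m::finite \<Rightarrow> ((real^'m) \<times> (real^'m) \<Rightarrow> complex) \<Rightarrow> (real^'m) \<times> (real^'m) \<Rightarrow> complex" where
  "du i = pd (0, axis i 1)"

definition laplace_x :: "((real^'m) \<times> (real^'m) \<Rightarrow> complex) \<Rightarrow> (real^'m) \<times> (real^'m) \<Rightarrow> complex" where
  "laplace_x f z = (\<Sum>i\<in>UNIV. dx i (dx i f) z)"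

text \<open>\<open>u_nabla_x\<close> is \<open>\<langle>u, \<nabla>\<^sub>x\<rangle>\<close>, and \<open>nabla_u_nabla_x\<close> is \<open>\<langle>\<nabla>\<^sub>u, \<nabla>\<^sub>x\<rangle>\<close>.\<close>

definition u_nabla_x :: "((real^'m) \<times> (real^'m) \<Rightarrow> complex) \<Rightarrow> (real^'m) \<times> (real^'m) \<Rightarrow> complex" where
  "u_nabla_x f z = (\<Sum>i\<in>UNIV. (snd z $ i) *\<^sub>R dx i f z)"

definition nabla_u_nabla_x :: "((real^'m) \<times> (real^'m) \<Rightarrow> complex) \<Rightarrow> (real^'m) \<times> (real^'m) \<Rightarrow> complex" where
  "nabla_u_nabla_x f z = (\<Sum>i\<in>UNIV. du i (dx i f) z)"

definition bosonic_laplacian ::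
    "nat \<Rightarrow> ((real^'m) \<times> (real^'m) \<Rightarrow> complex) \<Rightarrow> (real^'m) \<times> (real^'m) \<Rightarrow> complex" where
  "bosonic_laplacian k f z =
     (let m = real CARD('m); \<kappa> = real k in
      laplace_x f z
      - (4 / (m + 2 * \<kappa> - 2)) *\<^sub>R u_nabla_x (nabla_u_nabla_x f) z
      + (4 * (norm (snd z))\<^sup>2 / ((m + 2 * \<kappa> - 2) * (m + 2 * \<kappa> - 4)))
          *\<^sub>R nabla_u_nabla_x (nabla_u_nabla_x f) z)"

section \<open>The bosonic Bergman space, its kernel and its projection\<close>

definition L2 :: "'a::euclidean_space set \<Rightarrow> ('a \<Rightarrow> complex) set" where
  "L2 S = {f \<in> borel_measurable (lebesgue_on S). integrable (lebesgue_on S) (\<lambda>z. (cmod (f z))\<^sup>2)}"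

text \<open>
  Elements are total functions of which only the values on \<open>\<Omega> \<times> ball 0 1\<close> matter.
\<close>

definition bosonic_bergman :: "nat \<Rightarrow> (real^'m) set \<Rightarrow> ((real^'m) \<times> (real^'m) \<Rightarrow> complex) set" where
  "bosonic_bergman k \<Omega> =
    {f \<in> L2 (\<Omega> \<times> ball 0 1).
       Ck_on 2 f (\<Omega> \<times> ball 0 1) \<and>
       (\<forall>x\<in>\<Omega>. \<exists>p\<in>homogeneous_harmonic k. \<forall>u\<in>ball 0 1. f (x, u) = p u) \<and>
       (\<forall>z\<in>\<Omega> \<times> ball 0 1. bosonic_laplacian k f z = 0)}"

definition iterated_integral :: "(real^'m) set \<Rightarrow> ((real^'m) \<times> (real^'m) \<Rightarrow> complex) \<Rightarrow> complex" where
  "iterated_integral \<Omega> h =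
     integral\<^sup>L (lebesgue_on \<Omega>) (\<lambda>x. integral\<^sup>L (lebesgue_on (ball 0 1)) (\<lambda>u. h (x, u)))"

definition b2_inner ::
    "(real^'m) set \<Rightarrow> ((real^'m) \<times> (real^'m) \<Rightarrow> complex) \<Rightarrow> ((real^'m) \<times> (real^'m) \<Rightarrow> complex) \<Rightarrow> complex" where
  "b2_inner \<Omega> f g = iterated_integral \<Omega> (\<lambda>z. cnj (f z) * g z)"

text \<open>
  \<open>R y x u v\<close> is the kernel with integration variables \<open>(y,u)\<close> and evaluation point \<open>(x,v)\<close>.
  These conditions determine \<open>R y x u v\<close> for \<open>y, x \<in> \<Omega>\<close> and \<open>u, v \<in> ball 0 1\<close>: the
  difference of two candidates represents zero, so it is orthogonal to itself, and it is
  continuous.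
\<close>

definition is_reproducing_kernel ::
    "nat \<Rightarrow> (real^'m) set \<Rightarrow> (real^'m \<Rightarrow> real^'m \<Rightarrow> real^'m \<Rightarrow> real^'m \<Rightarrow> complex) \<Rightarrow> bool" where
  "is_reproducing_kernel k \<Omega> R \<longleftrightarrow>
     (\<forall>x\<in>\<Omega>. \<forall>v\<in>ball 0 1.
        (\<lambda>(y, u). R y x u v) \<in> bosonic_bergman k \<Omega> \<and>
        (\<forall>f\<in>bosonic_bergman k \<Omega>. f (x, v) = b2_inner \<Omega> (\<lambda>(y, u). R y x u v) f))"

text \<open>
  \<open>B f\<close> is the element of the Bergman space, hence the continuous representative of its
  \<open>L\<^sup>2\<close> class, with \<open>f - B f\<close> orthogonal to the Bergman space. This determines \<open>B f\<close> on
  \<open>\<Omega> \<times> ball 0 1\<close>.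
\<close>

definition is_bergman_projection ::
    "nat \<Rightarrow> (real^'m) set \<Rightarrow>
      (((real^'m) \<times> (real^'m) \<Rightarrow> complex) \<Rightarrow> (real^'m) \<times> (real^'m) \<Rightarrow> complex) \<Rightarrow> bool" where
  "is_bergman_projection k \<Omega> B \<longleftrightarrow>
     (\<forall>f\<in>L2 (\<Omega> \<times> ball 0 1).
        B f \<in> bosonic_bergman k \<Omega> \<and>
        (\<forall>g\<in>bosonic_bergman k \<Omega>. b2_inner \<Omega> g (\<lambda>z. f z - B f z) = 0))"

end

theory Submission
  imports Defs "HOL-Computational_Algebra.Polynomial"
begin

text \<open>
  The reproducing property, applied to \<open>B f\<close>, gives \<open>B f (x, v) = \<langle>r, B f\<rangle>\<close> with
  \<open>r (y, u) = R y x u v\<close>, and \<open>f - B f\<close> is orthogonal to \<open>r\<close>. Hence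
  \<open>B f (x, v) = \<langle>r, f\<rangle>\<close>, which is the claim except that the integrand contains the conjugate
  of the kernel. The conjugate disappears because the Bergman space is closed under
  conjugation (\<open>cnj_bosonic_bergman\<close>): the reproducing property for \<open>cnj (B f)\<close>, conjugated,
  reads \<open>B f (x, v) = \<integral>\<integral> r B f\<close>, and orthogonality of \<open>f - B f\<close> to \<open>cnj r\<close> reads
  \<open>\<integral>\<integral> r (f - B f) = 0\<close>. Adding the two identities gives the formula.

  Closure under conjugation holds because the bosonic Laplacian has real coefficients. The
  delicate point is that it involves derivatives of order up to four of a \<open>C\<^sup>2\<close> function.
  They exist because \<open>f(x,u)\<close> is a polynomial in \<open>u\<close> of degree at most \<open>k\<close> for every \<open>x\<close>:
  differentiating Lagrange's interpolation formula, a \<open>u\<close>-derivative of such a function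
  is a fixed linear combination of finitely many of its translates in \<open>u\<close>
  (\<open>polynomial_along_derivative_is_translates\<close>). So \<open>u\<close>-derivatives do not consume
  differentiability in \<open>x\<close>, while \<open>x\<close>-derivatives preserve polynomiality in \<open>u\<close>
  (\<open>polynomial_along_pd\<close>).

  Adding iterated integrals requires a version of Fubini's theorem for Lebesgue measurable,
  rather than Borel measurable, functions on a product (\<open>lebesgue_Fubini_integrable\<close>); the
  products that occur are integrable since both factors are square integrable.
\<close>

section \<open>Polynomials along lines\<close>

definition lagrange_basis :: "real set \<Rightarrow> real \<Rightarrow> real \<Rightarrow> real" where
  "lagrange_basis T s t = (\<Prod>r\<in>T - {s}. (t - r) / (s - r))"

lemma poly_eq_lagrange_sum:
  fixes q :: "real poly"
  assumes "finite T" "degree q < card T"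
  shows "poly q t = (\<Sum>s\<in>T. lagrange_basis T s t * poly q s)"
proof -
  define L where "L s = (\<Prod>r\<in>T - {s}. smult (1 / (s - r)) [:- r, 1:])" for s
  define p where "p = (\<Sum>s\<in>T. smult (poly q s) (L s))"
  have L: "poly (L s) t = lagrange_basis T s t" for s t
    by (simp add: L_def lagrange_basis_def poly_prod diff_divide_distrib)
  have "degree (L s) < card T" if "s \<in> T" for s
  proof -
    have "degree (L s) \<le> (\<Sum>r\<in>T - {s}. degree (smult (1 / (s - r)) [:- r, 1:]))"
      unfolding L_def
      using degree_prod_sum_le[of "T - {s}" "\<lambda>r. smult (1 / (s - r)) [:- r, 1:]"] assms(1)
      unfolding o_def by blast
    also have "\<dots> \<le> (\<Sum>r\<in>T - {s}. 1)"
      by (intro sum_mono) auto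
    also have "\<dots> = card (T - {s})"
      by simp
    also have "\<dots> < card T"
      using assms(1) that by (rule card_Diff1_less)
    finally show ?thesis .
  qed
  moreover have "0 < card T"
    using assms(2) by linarith
  ultimately have "degree p < card T"
    unfolding p_def
    by (cases "card T") (auto simp: less_Suc_eq_le intro!: degree_sum_le assms(1) order_trans[OF degree_smult_le])
  with assms(2) have deg: "degree (p - q) < card T"
    by (meson degree_diff_less)
  have "poly p s = poly q s" if "s \<in> T" for s
  proof -
    have "lagrange_basis T s' s = (if s' = s then 1 else 0)" if "s' \<in> T" for s'
      unfolding lagrange_basis_def using assms(1) that \<open>s \<in> T\<close> by (auto intro!: prod.neutral)
    then have "poly p s = (\<Sum>s'\<in>T. if s' = s then poly q s' else 0)"
      unfolding p_def by (auto simp: poly_sum L intro!: sum.cong)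
    then show ?thesis
      using assms(1) that by simp
  qed
  then have "T \<subseteq> {s. poly (p - q) s = 0}"
    by auto
  then have "p - q = 0"
    by (metis assms(1) card_mono card_poly_roots_bound deg leD order_trans poly_roots_finite)
  then have "poly q t = poly p t"
    by simp
  then show ?thesis
    by (simp add: p_def poly_sum L mult.commute)
qed

text \<open>
  On each line with direction \<open>d\<close>, \<open>F\<close> agrees with a polynomial of degree at most \<open>N\<close>,
  expressed by Lagrange's interpolation identity at every choice of \<open>N + 1\<close> nodes. For fixed
  nodes the identity is linear in finitely many values of \<open>F\<close>. Unlike the existence of
  coefficients, such a condition is visibly inherited by derivatives of \<open>F\<close> in any direction.
\<close>

definition polynomial_along ::
    "nat \<Rightarrow> 'a::real_normed_vector set \<Rightarrow> 'a \<Rightarrow> ('a \<Rightarrow> 'b::real_normed_vector) \<Rightarrow> bool" where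
  "polynomial_along N S d F \<longleftrightarrow>
     (\<forall>z T t. finite T \<and> card T = Suc N \<and> (\<forall>s\<in>insert t T. z + s *\<^sub>R d \<in> S) \<longrightarrow>
        F (z + t *\<^sub>R d) = (\<Sum>s\<in>T. lagrange_basis T s t *\<^sub>R F (z + s *\<^sub>R d)))"

definition differentiable_along ::
    "'a::real_normed_vector set \<Rightarrow> 'a \<Rightarrow> ('a \<Rightarrow> 'b::real_normed_vector) \<Rightarrow> bool" where
  "differentiable_along S e F \<longleftrightarrow> (\<forall>z\<in>S. (\<lambda>t::real. F (z + t *\<^sub>R e)) differentiable (at 0))"

lemma polynomial_alongD:
  assumes "polynomial_along N S d F" "finite T" "card T = Suc N" "\<And>s. s \<in> insert t T \<Longrightarrow> z + s *\<^sub>R d \<in> S"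
  shows "F (z + t *\<^sub>R d) = (\<Sum>s\<in>T. lagrange_basis T s t *\<^sub>R F (z + s *\<^sub>R d))"
  using assms unfolding polynomial_along_def by blast

lemma polynomial_along_sum:
  assumes "\<And>i. i \<in> I \<Longrightarrow> polynomial_along N S d (F i)"
  shows "polynomial_along N S d (\<lambda>z. \<Sum>i\<in>I. F i z)"
  unfolding polynomial_along_def
proof (intro allI impI)
  fix z T and t :: real
  assume *: "finite T \<and> card T = Suc N \<and> (\<forall>s\<in>insert t T. z + s *\<^sub>R d \<in> S)"
  have "(\<Sum>i\<in>I. F i (z + t *\<^sub>R d)) = (\<Sum>i\<in>I. \<Sum>s\<in>T. lagrange_basis T s t *\<^sub>R F i (z + s *\<^sub>R d))"
    using * by (intro sum.cong polynomial_alongD[OF assms]) auto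
  then show "(\<Sum>i\<in>I. F i (z + t *\<^sub>R d)) = (\<Sum>s\<in>T. lagrange_basis T s t *\<^sub>R (\<Sum>i\<in>I. F i (z + s *\<^sub>R d)))"
    by (subst (asm) sum.swap) (simp add: scaleR_sum_right)
qed

lemma differentiable_along_sum:
  assumes "finite I" "\<And>i. i \<in> I \<Longrightarrow> differentiable_along S e (F i)"
  shows "differentiable_along S e (\<lambda>z. \<Sum>i\<in>I. F i z)"
  using assms unfolding differentiable_along_def by (auto intro!: differentiable_sum)

lemma has_vector_derivative_pd:
  assumes "differentiable_along S e F" "z \<in> S"
  shows "((\<lambda>t. F (z + t *\<^sub>R e)) has_vector_derivative pd e F z) (at 0)"
  using assms by (auto simp: differentiable_along_def pd_def vector_derivative_works)

lemma tendsto_along_line: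
  fixes z :: "'a::real_normed_vector"
  shows "((\<lambda>t::real. z + t *\<^sub>R e) \<longlongrightarrow> z) (nhds 0)"
proof -
  have "isCont (\<lambda>t::real. z + t *\<^sub>R e) 0"
    by (intro continuous_intros)
  then show ?thesis
    by (simp add: isCont_def tendsto_at_iff_tendsto_nhds[of "\<lambda>t. z + t *\<^sub>R e" 0, simplified])
qed

lemma eventually_line_in_open:
  fixes S :: "'a::real_normed_vector set"
  assumes "open S" "z \<in> S"
  shows "\<forall>\<^sub>F t::real in nhds 0. z + t *\<^sub>R e \<in> S"
  using tendsto_along_line assms by (rule topological_tendstoD)

lemma pd_cong_open:
  assumes "open S" "z \<in> S" "\<And>y. y \<in> S \<Longrightarrow> F y = G y"
  shows "pd e F z = pd e G z"
proof -
  have "\<forall>\<^sub>F t in nhds (0::real). F (z + t *\<^sub>R e) = G (z + t *\<^sub>R e)"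
    by (rule eventually_mono[OF eventually_line_in_open[OF assms(1,2)]]) (rule assms(3))
  then show ?thesis
    unfolding pd_def vector_derivative_def
    using assms by (subst has_vector_derivative_cong_ev) (auto elim: eventually_mono)
qed

text \<open>
  Translating the base point by \<open>r *\<^sub>R e\<close> keeps the finitely many nodes inside the open
  set \<open>S\<close> for small \<open>r\<close>, so the interpolation identity can be differentiated in \<open>r\<close>.
\<close>

lemma polynomial_along_pd:
  assumes "open S" "polynomial_along N S d F" "differentiable_along S e F"
  shows "polynomial_along N S d (pd e F)"
  unfolding polynomial_along_def
proof (intro allI impI)
  fix z T and t :: real
  assume *: "finite T \<and> card T = Suc N \<and> (\<forall>s\<in>insert t T. z + s *\<^sub>R d \<in> S)"
  let ?R = "\<lambda>r. \<Sum>s\<in>T. lagrange_basis T s t *\<^sub>R F (z + s *\<^sub>R d + r *\<^sub>R e)"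
  have "\<forall>\<^sub>F r in nhds (0::real). \<forall>s\<in>insert t T. z + s *\<^sub>R d + r *\<^sub>R e \<in> S"
    using * by (intro eventually_ball_finite ballI eventually_line_in_open assms(1)) auto
  then have "\<forall>\<^sub>F r in nhds 0. F (z + t *\<^sub>R d + r *\<^sub>R e) = ?R r"
  proof eventually_elim
    case (elim r)
    then have "F (z + r *\<^sub>R e + t *\<^sub>R d) = (\<Sum>s\<in>T. lagrange_basis T s t *\<^sub>R F (z + r *\<^sub>R e + s *\<^sub>R d))"
      using * by (intro polynomial_alongD[OF assms(2)]) (auto simp: add_ac)
    then show ?case
      by (simp add: add_ac)
  qed
  moreover have "(?R has_vector_derivative (\<Sum>s\<in>T. lagrange_basis T s t *\<^sub>R pd e F (z + s *\<^sub>R d))) (at 0)"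
    using * by (auto intro!: has_vector_derivative_sum derivative_eq_intros has_vector_derivative_pd[OF assms(3)])
  ultimately have "((\<lambda>r. F (z + t *\<^sub>R d + r *\<^sub>R e)) has_vector_derivative
      (\<Sum>s\<in>T. lagrange_basis T s t *\<^sub>R pd e F (z + s *\<^sub>R d))) (at 0)"
    by (subst has_vector_derivative_cong_ev) (auto elim: eventually_mono dest: eventually_nhds_x_imp_x)
  then show "pd e F (z + t *\<^sub>R d) = (\<Sum>s\<in>T. lagrange_basis T s t *\<^sub>R pd e F (z + s *\<^sub>R d))"
    unfolding pd_def[of e F "z + t *\<^sub>R d"] by (rule vector_derivative_at)
qed

text \<open>
  Differentiating the interpolation identity in the interpolation variable expresses the
  derivative along \<open>d\<close> by finitely many translates. The nodes and coefficients serve all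
  base points near \<open>z\<close> and all functions \<open>F\<close> at once, so the formula can be differentiated
  again in another direction.
\<close>

lemma polynomial_along_derivative_is_translates:
  fixes S :: "'a::real_normed_vector set"
  assumes "open S" "z \<in> S"
  obtains T :: "real set" and c where "finite T"
    and "\<forall>\<^sub>F y in nhds z. (\<forall>s\<in>T. y + s *\<^sub>R d \<in> S) \<and>
      (\<forall>F::'a \<Rightarrow> 'b::real_normed_vector. polynomial_along N S d F \<longrightarrow>
        ((\<lambda>t. F (y + t *\<^sub>R d)) has_vector_derivative (\<Sum>s\<in>T. c s *\<^sub>R F (y + s *\<^sub>R d))) (at 0))"
proof -
  obtain \<delta> where \<delta>: "0 < \<delta>" "ball z \<delta> \<subseteq> S"
    using assms open_contains_ball by blast
  \<comment> \<open>Segments of length \<open>\<epsilon> * norm d\<close> from points within \<open>\<delta> / 2\<close> of \<open>z\<close> stay in the ball; the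
    nodes are spread over \<open>[0, \<epsilon>)\<close>.\<close>
  define \<epsilon> where "\<epsilon> = \<delta> / (2 * (norm d + 1))"
  have \<epsilon>: "0 < \<epsilon>" "\<epsilon> * norm d < \<delta> / 2"
    using \<delta> by (auto simp: \<epsilon>_def field_simps add_pos_nonneg intro!: add_strict_increasing2)
  define T where "T = (\<lambda>i. \<epsilon> * real i / real (Suc N)) ` {..N}"
  have "inj_on (\<lambda>i. \<epsilon> * real i / real (Suc N)) {..N}"
    using \<epsilon> by (auto intro!: inj_onI simp del: of_nat_Suc)
  then have T: "finite T" "card T = Suc N"
    by (auto simp: T_def card_image)
  have T_le: "\<bar>s\<bar> \<le> \<epsilon>" if "s \<in> T" for s
    using that \<epsilon> by (auto simp: T_def abs_mult divide_simps simp del: of_nat_Suc)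
  define c where "c s = vector_derivative (lagrange_basis T s) (at 0)" for s
  have "real_polynomial_function (lagrange_basis T s)" for s
    unfolding lagrange_basis_def using T
    by (intro real_polynomial_function_prod real_polynomial_function_divide real_polynomial_function_diff)
      (simp_all add: real_polynomial_function_eq)
  then have c: "(lagrange_basis T s has_vector_derivative c s) (at 0)" for s
    unfolding c_def vector_derivative_works[symmetric]
    by (simp add: differentiable_at_real_polynomial_function)
  have near: "y + s *\<^sub>R d \<in> S" if "dist y z < \<delta> / 2" "\<bar>s\<bar> \<le> \<epsilon>" for y s
  proof -
    have "dist (y + s *\<^sub>R d) z \<le> dist y z + \<bar>s\<bar> * norm d"
      by (metis (no_types) dist_norm add_diff_eq add.commute norm_scaleR norm_triangle_ineq)
    also have "\<dots> < \<delta>"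
      using that \<epsilon> mult_right_mono[OF that(2), of "norm d"] by simp
    finally show ?thesis
      using \<delta> by (auto simp: dist_commute)
  qed
  have "\<forall>\<^sub>F y in nhds z. dist y z < \<delta> / 2"
    using \<delta> by (auto simp: eventually_nhds_metric intro!: exI[of _ "\<delta> / 2"])
  then have "\<forall>\<^sub>F y in nhds z. (\<forall>s\<in>T. y + s *\<^sub>R d \<in> S) \<and>
      (\<forall>F::'a \<Rightarrow> 'b. polynomial_along N S d F \<longrightarrow>
        ((\<lambda>t. F (y + t *\<^sub>R d)) has_vector_derivative (\<Sum>s\<in>T. c s *\<^sub>R F (y + s *\<^sub>R d))) (at 0))"
  proof (eventually_elim, intro conjI ballI allI impI)
    fix y s assume "dist y z < \<delta> / 2" "s \<in> T"
    then show "y + s *\<^sub>R d \<in> S"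
      using near T_le by blast
  next
    fix y and F :: "'a \<Rightarrow> 'b"
    assume y: "dist y z < \<delta> / 2" and F: "polynomial_along N S d F"
    have "((\<lambda>t. \<Sum>s\<in>T. lagrange_basis T s t *\<^sub>R F (y + s *\<^sub>R d)) has_vector_derivative
        (\<Sum>s\<in>T. c s *\<^sub>R F (y + s *\<^sub>R d))) (at 0)"
      using c by (auto intro!: has_vector_derivative_sum derivative_eq_intros simp: has_real_derivative_iff_has_vector_derivative)
    then show "((\<lambda>t. F (y + t *\<^sub>R d)) has_vector_derivative (\<Sum>s\<in>T. c s *\<^sub>R F (y + s *\<^sub>R d))) (at 0)"
    proof (rule has_vector_derivative_transform_within[where d = \<epsilon>])
      fix t :: real assume "dist t 0 < \<epsilon>"
      then show "(\<Sum>s\<in>T. lagrange_basis T s t *\<^sub>R F (y + s *\<^sub>R d)) = F (y + t *\<^sub>R d)"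
        using near[OF y] T_le by (intro polynomial_alongD[OF F T, symmetric]) auto
    qed (use \<epsilon> in auto)
  qed
  with T show ?thesis
    by (intro that)
qed

lemma polynomial_along_imp_differentiable_along:
  fixes F :: "'a::real_normed_vector \<Rightarrow> 'b::real_normed_vector"
  assumes "open S" "polynomial_along N S d F"
  shows "differentiable_along S d F"
  unfolding differentiable_along_def
proof
  fix z assume z: "z \<in> S"
  obtain T :: "real set" and c where
    ev: "\<forall>\<^sub>F y in nhds z. (\<forall>s\<in>T. y + s *\<^sub>R d \<in> S) \<and>
      (\<forall>F::'a \<Rightarrow> 'b. polynomial_along N S d F \<longrightarrow>
        ((\<lambda>t. F (y + t *\<^sub>R d)) has_vector_derivative (\<Sum>s\<in>T. c s *\<^sub>R F (y + s *\<^sub>R d))) (at 0))"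
    using polynomial_along_derivative_is_translates[OF assms(1) z] by blast
  then have "((\<lambda>t. F (z + t *\<^sub>R d)) has_vector_derivative (\<Sum>s\<in>T. c s *\<^sub>R F (z + s *\<^sub>R d))) (at 0)"
    using eventually_nhds_x_imp_x[OF ev] assms(2) by blast
  then show "(\<lambda>t. F (z + t *\<^sub>R d)) differentiable at 0"
    by (rule differentiableI_vector)
qed

text \<open>
  A derivative of \<open>F\<close> along \<open>d\<close> is locally a combination of translates of \<open>F\<close>, so it loses
  no regularity in the direction \<open>e\<close>. This supplies the derivatives in the bosonic Laplacian
  that the class \<open>C\<^sup>2\<close> alone does not.
\<close>

lemma differentiable_along_pd:
  fixes F :: "'a::real_normed_vector \<Rightarrow> 'b::real_normed_vector"
  assumes "open S" "polynomial_along N S d F" "differentiable_along S e F"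
  shows "differentiable_along S e (pd d F)"
  unfolding differentiable_along_def
proof
  fix z assume z: "z \<in> S"
  obtain T :: "real set" and c where T: "finite T"
    and ev: "\<forall>\<^sub>F y in nhds z. (\<forall>s\<in>T. y + s *\<^sub>R d \<in> S) \<and>
      (\<forall>F::'a \<Rightarrow> 'b. polynomial_along N S d F \<longrightarrow>
        ((\<lambda>t. F (y + t *\<^sub>R d)) has_vector_derivative (\<Sum>s\<in>T. c s *\<^sub>R F (y + s *\<^sub>R d))) (at 0))"
    using polynomial_along_derivative_is_translates[OF assms(1) z] by blast
  let ?G = "\<lambda>y. \<Sum>s\<in>T. c s *\<^sub>R F (y + s *\<^sub>R d)"
  have "\<forall>\<^sub>F y in nhds z. pd d F y = ?G y"
    using ev by eventually_elim (use assms(2) in \<open>auto simp: pd_def intro: vector_derivative_at\<close>)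
  then have eq: "\<forall>\<^sub>F t in nhds 0. pd d F (z + t *\<^sub>R e) = ?G (z + t *\<^sub>R e)"
    using tendsto_along_line by (rule eventually_compose_filterlim)
  have in_S: "z + s *\<^sub>R d \<in> S" if "s \<in> T" for s
    using eventually_nhds_x_imp_x[OF ev] that by blast
  have "((\<lambda>t. \<Sum>s\<in>T. c s *\<^sub>R F (z + s *\<^sub>R d + t *\<^sub>R e)) has_vector_derivative
      (\<Sum>s\<in>T. c s *\<^sub>R pd e F (z + s *\<^sub>R d))) (at 0)"
    by (auto intro!: has_vector_derivative_sum derivative_eq_intros has_vector_derivative_pd[OF assms(3)] in_S)
  then have "((\<lambda>t. ?G (z + t *\<^sub>R e)) has_vector_derivative (\<Sum>s\<in>T. c s *\<^sub>R pd e F (z + s *\<^sub>R d))) (at 0)"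
    by (simp add: add_ac)
  then have "((\<lambda>t. pd d F (z + t *\<^sub>R e)) has_vector_derivative (\<Sum>s\<in>T. c s *\<^sub>R pd e F (z + s *\<^sub>R d))) (at 0)"
    using eq by (subst has_vector_derivative_cong_ev) (auto elim: eventually_mono dest: eventually_nhds_x_imp_x)
  then show "(\<lambda>t. pd d F (z + t *\<^sub>R e)) differentiable at 0"
    by (rule differentiableI_vector)
qed

text \<open>
  The restriction \<open>Q\<close> of \<open>q\<close> to a line has degree at most \<open>k\<close>: by homogeneity
  \<open>r\<^sup>k Q(1/r) = q (d + r *\<^sub>R z)\<close> stays bounded as \<open>r\<close> tends to \<open>0\<close>. Homogeneity thus gives
  a degree bound that depends on \<open>k\<close> only and hence is uniform in the parameter \<open>x\<close>.
\<close>

lemma real_homogeneous_polynomial_along: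
  fixes q :: "'a::real_normed_vector \<Rightarrow> real"
  assumes "real_polynomial_function q" and hom: "\<And>t u. q (t *\<^sub>R u) = t ^ k * q u"
  shows "polynomial_along k S d q"
  unfolding polynomial_along_def
proof (intro allI impI)
  fix z T and t :: real
  assume *: "finite T \<and> card T = Suc k \<and> (\<forall>s\<in>insert t T. z + s *\<^sub>R d \<in> S)"
  have line: "\<exists>Q. \<forall>t. q (a + t *\<^sub>R b) = poly Q t" for a b
  proof -
    have "polynomial_function (\<lambda>t. a + t *\<^sub>R b)"
      by (intro polynomial_function_add polynomial_function_const
          polynomial_function_bounded_linear bounded_linear_scaleR_left)
    then have "real_polynomial_function (q \<circ> (\<lambda>t. a + t *\<^sub>R b))"
      using assms(1) by (rule real_polynomial_function_compose)
    then obtain c n where "q \<circ> (\<lambda>t. a + t *\<^sub>R b) = (\<lambda>t. \<Sum>i\<le>n. c i * t ^ i)"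
      by (auto simp: real_polynomial_function_iff_sum)
    then have "q (a + t *\<^sub>R b) = poly (\<Sum>i\<le>n. monom (c i) i) t" for t
      by (auto simp: poly_sum poly_monom dest: fun_cong)
    then show ?thesis by blast
  qed
  obtain Q where Q: "\<And>t. q (z + t *\<^sub>R d) = poly Q t"
    using line by blast
  obtain P where P: "\<And>t. q (d + t *\<^sub>R z) = poly P t"
    using line by blast
  have "degree Q \<le> k"
  proof (rule ccontr)
    assume "\<not> degree Q \<le> k"
    then have n: "k < degree Q" by simp
    have "poly (reflect_poly Q) r = poly (monom 1 (degree Q - k) * P) r" if "r \<noteq> 0" for r
    proof -
      have "r *\<^sub>R (z + inverse r *\<^sub>R d) = d + r *\<^sub>R z"
        using that by (simp add: scaleR_add_right)
      then have "poly P r = r ^ k * poly Q (inverse r)"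
        by (metis P Q hom)
      then show ?thesis
        using that n by (simp add: poly_reflect_poly_nz poly_monom flip: power_add)
    qed
    \<comment> \<open>The factor \<open>X\<close> extends the equality from \<open>r \<noteq> 0\<close> to all \<open>r\<close>.\<close>
    then have "[:0, 1:] * reflect_poly Q = [:0, 1:] * (monom 1 (degree Q - k) * P)"
      by (intro poly_ext) auto
    then have "reflect_poly Q = monom 1 (degree Q - k) * P"
      by simp
    then have "poly (reflect_poly Q) 0 = 0"
      using n by (simp add: poly_monom)
    then show False
      using n by (simp add: poly_0_coeff_0)
  qed
  then show "q (z + t *\<^sub>R d) = (\<Sum>s\<in>T. lagrange_basis T s t *\<^sub>R q (z + s *\<^sub>R d))"
    using * poly_eq_lagrange_sum[of T Q t] by (simp add: Q)
qed

lemma homogeneous_harmonic_polynomial_along: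
  assumes "p \<in> homogeneous_harmonic k"
  shows "polynomial_along k S d p"
proof -
  from assms have "polynomial_function p" and hom: "\<And>t u. p (t *\<^sub>R u) = t ^ k *\<^sub>R p u"
    by (auto simp: homogeneous_harmonic_def)
  then have "real_polynomial_function (Re \<circ> p)" "real_polynomial_function (Im \<circ> p)"
    by (simp_all add: polynomial_function_def bounded_linear_Re bounded_linear_Im)
  then have "polynomial_along k S d (Re \<circ> p)" "polynomial_along k S d (Im \<circ> p)"
    by (auto intro!: real_homogeneous_polynomial_along simp: hom)
  then show ?thesis
    unfolding polynomial_along_def by (simp add: complex_eq_iff)
qed

section \<open>Conjugation and the bosonic Bergman space\<close>

lemma pd_cnj:
  assumes "differentiable_along S e F" "z \<in> S"
  shows "pd e (\<lambda>y. cnj (F y)) z = cnj (pd e F z)"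
  unfolding pd_def[of e "\<lambda>y. cnj (F y)"]
  by (intro vector_derivative_at has_vector_derivative_cnj has_vector_derivative_pd[OF assms])

lemma cnj_homogeneous_harmonic:
  assumes "p \<in> homogeneous_harmonic k"
  shows "(\<lambda>u. cnj (p u)) \<in> homogeneous_harmonic k"
proof -
  from assms have p: "polynomial_function p" "\<And>t u. p (t *\<^sub>R u) = t ^ k *\<^sub>R p u" "\<And>u. laplacian p u = 0"
    by (auto simp: homogeneous_harmonic_def)
  have poly: "polynomial_along k UNIV d p" for d
    using assms by (rule homogeneous_harmonic_polynomial_along)
  have 1: "differentiable_along UNIV i p" for i
    by (rule polynomial_along_imp_differentiable_along[OF open_UNIV poly])
  have 2: "differentiable_along UNIV i (pd i p)" for i
    by (rule polynomial_along_imp_differentiable_along[OF open_UNIV polynomial_along_pd[OF open_UNIV poly 1]])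
  have "pd i (\<lambda>u. cnj (p u)) = (\<lambda>u. cnj (pd i p u))" for i
    using pd_cnj[OF 1] by auto
  then have "laplacian (\<lambda>u. cnj (p u)) u = cnj (laplacian p u)" for u
    by (simp add: laplacian_def pd_cnj[OF 2])
  moreover have "polynomial_function (\<lambda>u. cnj (p u))"
    using p(1) bounded_linear_compose[OF _ bounded_linear_cnj]
    unfolding polynomial_function_def o_def by auto
  ultimately show ?thesis
    using p by (simp add: homogeneous_harmonic_def)
qed

lemma differentiable_on_imp_differentiable_along:
  assumes "open S" "F differentiable_on S"
  shows "differentiable_along S e F"
  unfolding differentiable_along_def
proof
  fix z assume "z \<in> S"
  then have "F differentiable at ((\<lambda>t::real. z + t *\<^sub>R e) 0)"
    using assms by (simp add: differentiable_on_eq_differentiable_at)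
  moreover have "(\<lambda>t::real. z + t *\<^sub>R e) differentiable at 0"
    by (rule differentiableI_vector[of _ e]) (auto intro!: derivative_eq_intros)
  ultimately show "(\<lambda>t. F (z + t *\<^sub>R e)) differentiable at 0"
    by (rule differentiable_compose[of F "\<lambda>t. z + t *\<^sub>R e" 0 UNIV])
qed

lemma Ck_on_cong_open:
  assumes "open S" "\<And>z. z \<in> S \<Longrightarrow> F z = G z" "Ck_on n F S"
  shows "Ck_on n G S"
  using assms(2,3)
proof (induction n arbitrary: F G)
  case 0
  then show ?case by (simp cong: continuous_on_cong)
next
  case (Suc n)
  have "Ck_on n (pd i G) S" if "i \<in> Basis" for i
  proof (rule Suc.IH)
    show "pd i F z = pd i G z" if "z \<in> S" for z
      by (rule pd_cong_open[OF assms(1) that Suc.prems(1)])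
    show "Ck_on n (pd i F) S"
      using Suc.prems(2) that by simp
  qed
  moreover have "G differentiable_on S"
    unfolding differentiable_on_def
  proof
    fix z assume z: "z \<in> S"
    have "F differentiable at z within S"
      using Suc.prems(2) z by (simp add: differentiable_on_def)
    then show "G differentiable at z within S"
      by (rule differentiable_transform_within[OF _ zero_less_one z Suc.prems(1)])
  qed
  ultimately show ?case by simp
qed

lemma Ck_on_cnj:
  assumes "open S" "Ck_on n F S"
  shows "Ck_on n (\<lambda>z. cnj (F z)) S"
  using assms(2)
proof (induction n arbitrary: F)
  case 0
  then show ?case by (simp add: continuous_on_cnj)
next
  case (Suc n)
  then have F: "F differentiable_on S" by simp
  have "Ck_on n (pd i (\<lambda>z. cnj (F z))) S" if "i \<in> Basis" for i
  proof (rule Ck_on_cong_open[OF assms(1)])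
    show "Ck_on n (\<lambda>z. cnj (pd i F z)) S"
      using Suc that by simp
    show "cnj (pd i F z) = pd i (\<lambda>z. cnj (F z)) z" if "z \<in> S" for z
      by (rule pd_cnj[OF differentiable_on_imp_differentiable_along[OF assms(1) F] that, symmetric])
  qed
  moreover have "(\<lambda>z. cnj (F z)) differentiable_on S"
    using F differentiable_chain_within[of F _ S cnj]
    by (auto simp: differentiable_on_def o_def bounded_linear_imp_differentiable bounded_linear_cnj differentiable_at_withinI)
  ultimately show ?case by simp
qed

lemma
  fixes F F' :: "(real^'m) \<times> (real^'m) \<Rightarrow> complex"
  assumes "open S" and "\<And>w. polynomial_along N S (0, w) F"
    and "\<And>j. differentiable_along S (axis j 1, 0) F"
    and "\<And>z. z \<in> S \<Longrightarrow> F' z = cnj (F z)" and "z \<in> S"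
  shows u_nabla_x_cnj: "u_nabla_x F' z = cnj (u_nabla_x F z)"
    and nabla_u_nabla_x_cnj: "nabla_u_nabla_x F' z = cnj (nabla_u_nabla_x F z)"
proof -
  have dx: "dx i F' y = cnj (dx i F y)" if "y \<in> S" for i y
    unfolding dx_def pd_cnj[OF assms(3) that, symmetric] by (rule pd_cong_open[OF assms(1) that assms(4)])
  then show "u_nabla_x F' z = cnj (u_nabla_x F z)"
    using \<open>z \<in> S\<close> by (simp add: u_nabla_x_def)
  have diff: "differentiable_along S (0, axis i 1) (dx i F)" for i
    unfolding dx_def
    by (rule polynomial_along_imp_differentiable_along[OF assms(1) polynomial_along_pd[OF assms(1-3)]])
  have "du i (dx i F') z = cnj (du i (dx i F) z)" for i
    unfolding du_def pd_cnj[OF diff \<open>z \<in> S\<close>, symmetric]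
    by (rule pd_cong_open[OF assms(1,5) dx])
  then show "nabla_u_nabla_x F' z = cnj (nabla_u_nabla_x F z)"
    by (simp add: nabla_u_nabla_x_def)
qed

text \<open>
  The coefficients of the bosonic Laplacian are real. Conjugation commutes with a partial
  derivative only where that derivative exists, because a missing derivative has an unspecified
  value. The proof therefore establishes existence and polynomiality in \<open>u\<close> for every
  intermediate function, in particular for \<open>\<langle>\<nabla>\<^sub>u, \<nabla>\<^sub>x\<rangle> f\<close>.
\<close>

lemma bosonic_laplacian_cnj:
  fixes f :: "(real^'m) \<times> (real^'m) \<Rightarrow> complex"
  assumes S: "open S" and f: "Ck_on 2 f S" and poly: "\<And>w. polynomial_along N S (0, w) f"
    and z: "z \<in> S"
  shows "bosonic_laplacian k (\<lambda>z. cnj (f z)) z = cnj (bosonic_laplacian k f z)"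
proof -
  let ?f' = "\<lambda>z. cnj (f z)"
  have basis: "(axis i 1, 0) \<in> (Basis :: ((real^'m) \<times> (real^'m)) set)" for i
    by (auto simp: Basis_prod_def axis_in_Basis_iff)
  have 1: "differentiable_along S e f" for e
    using f by (auto simp: numeral_2_eq_2 intro: differentiable_on_imp_differentiable_along[OF S])
  have 2: "differentiable_along S e (dx i f)" for e i
    using f basis by (auto simp: numeral_2_eq_2 dx_def intro: differentiable_on_imp_differentiable_along[OF S])
  have poly_dx: "polynomial_along N S (0, w) (dx i f)" for w i
    unfolding dx_def by (rule polynomial_along_pd[OF S poly 1])
  have poly_G: "polynomial_along N S (0, w) (nabla_u_nabla_x f)" for w
    unfolding nabla_u_nabla_x_def[abs_def] du_def
    by (intro polynomial_along_sum polynomial_along_pd[OF S poly_dx] 2)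
  have diff_G: "differentiable_along S e (nabla_u_nabla_x f)" for e
    unfolding nabla_u_nabla_x_def[abs_def] du_def
    by (intro differentiable_along_sum differentiable_along_pd[OF S poly_dx 2]) simp
  have G: "nabla_u_nabla_x ?f' y = cnj (nabla_u_nabla_x f y)" if "y \<in> S" for y
    by (rule nabla_u_nabla_x_cnj[OF S poly 1 refl that])
  have "dx i (dx i ?f') z = cnj (dx i (dx i f) z)" for i
  proof -
    have "dx i ?f' y = cnj (dx i f y)" if "y \<in> S" for y
      unfolding dx_def by (rule pd_cnj[OF 1 that])
    then have "pd (axis i 1, 0) (dx i ?f') z = pd (axis i 1, 0) (\<lambda>y. cnj (dx i f y)) z"
      by (rule pd_cong_open[OF S z])
    then show ?thesis
      using pd_cnj[OF 2 z] by (simp add: dx_def)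
  qed
  then show ?thesis
    using u_nabla_x_cnj[OF S poly_G diff_G G z] nabla_u_nabla_x_cnj[OF S poly_G diff_G G z]
    by (simp add: bosonic_laplacian_def laplace_x_def Let_def)
qed

lemma cnj_L2: "f \<in> L2 S \<Longrightarrow> (\<lambda>z. cnj (f z)) \<in> L2 S"
  unfolding L2_def
  using measurable_compose[OF _ borel_measurable_continuous_onI[OF continuous_on_cnj[OF continuous_on_id]]]
  by auto

text \<open>
  Applied to the kernel and to the projected function, this removes the conjugate from the
  integral formula for the projection.
\<close>

lemma cnj_bosonic_bergman:
  assumes "open \<Omega>" "f \<in> bosonic_bergman k \<Omega>"
  shows "(\<lambda>z. cnj (f z)) \<in> bosonic_bergman k \<Omega>"
proof -
  let ?S = "\<Omega> \<times> (ball 0 1 :: (real^'a) set)"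
  have S: "open ?S"
    using assms(1) by (simp add: open_Times)
  from assms(2) have f: "f \<in> L2 ?S" "Ck_on 2 f ?S" "\<And>z. z \<in> ?S \<Longrightarrow> bosonic_laplacian k f z = 0"
    and harm: "\<And>x. x \<in> \<Omega> \<Longrightarrow> \<exists>p\<in>homogeneous_harmonic k. \<forall>u\<in>ball 0 1. f (x, u) = p u"
    unfolding bosonic_bergman_def by blast+
  have poly: "polynomial_along k ?S (0, w) f" for w
    unfolding polynomial_along_def
  proof (intro allI impI)
    fix z T and t :: real
    assume *: "finite T \<and> card T = Suc k \<and> (\<forall>s\<in>insert t T. z + s *\<^sub>R (0, w) \<in> ?S)"
    obtain x u where z: "z = (x, u)" by fastforce
    with * harm[of x] obtain p where p: "p \<in> homogeneous_harmonic k" "\<forall>u\<in>ball 0 1. f (x, u) = p u"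
      by auto
    then show "f (z + t *\<^sub>R (0, w)) = (\<Sum>s\<in>T. lagrange_basis T s t *\<^sub>R f (z + s *\<^sub>R (0, w)))"
      using * polynomial_alongD[OF homogeneous_harmonic_polynomial_along[OF p(1), of UNIV w], of T t u]
      by (simp add: z)
  qed
  show ?thesis
    unfolding bosonic_bergman_def
  proof (intro CollectI conjI ballI)
    show "(\<lambda>z. cnj (f z)) \<in> L2 ?S"
      by (rule cnj_L2[OF f(1)])
    show "Ck_on 2 (\<lambda>z. cnj (f z)) ?S"
      by (rule Ck_on_cnj[OF S f(2)])
    show "\<exists>p\<in>homogeneous_harmonic k. \<forall>u\<in>ball 0 1. cnj (f (x, u)) = p u" if "x \<in> \<Omega>" for x
      using harm[OF that] cnj_homogeneous_harmonic by force
    show "bosonic_laplacian k (\<lambda>z. cnj (f z)) z = 0" if "z \<in> ?S" for z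
      using bosonic_laplacian_cnj[OF S f(2) poly that] f(3)[OF that] by simp
  qed
qed

section \<open>Iterated integrals with respect to Lebesgue measure\<close>

lemma lebesgue_ex_borel_AE_eq:
  fixes h :: "'a::euclidean_space \<Rightarrow> complex"
  assumes "h \<in> borel_measurable lebesgue"
  obtains g where "g \<in> borel_measurable lborel" "AE z in lborel. h z = g z"
proof -
  have "(\<lambda>z. Re (h z)) \<in> borel_measurable lebesgue" "(\<lambda>z. Im (h z)) \<in> borel_measurable lebesgue"
    using assms by measurable
  then obtain a b where "a \<in> borel_measurable lborel" "AE z in lborel. Re (h z) = a z"
    and "b \<in> borel_measurable lborel" "AE z in lborel. Im (h z) = b z"
    using completion_ex_borel_measurable_real by metis
  then show ?thesis
    by (intro that[of "\<lambda>z. Complex (a z) (b z)"])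
      (auto simp: complex_eq_iff borel_measurable_complex_iff)
qed

lemma integrable_AE_eq_lebesgue:
  fixes f g :: "'a::euclidean_space \<Rightarrow> complex"
  assumes "integrable lborel g" "AE z in lborel. f z = g z"
  shows "integrable lebesgue f"
proof -
  have g: "integrable lebesgue g"
    using assms(1) by (simp add: integrable_completion borel_measurable_integrable)
  have ae: "AE z in lebesgue. g z = f z"
    using AE_completion[OF assms(2)] by (auto elim: AE_mp)
  then have "f \<in> borel_measurable lebesgue"
    using borel_measurable_AE[of g f] borel_measurable_integrable[OF g] by blast
  then show ?thesis
    using g ae integrable_cong_AE_imp by blast
qed

text \<open>
  The product of the completed measures is not complete, so the Fubini theorem for product
  measures does not apply to \<open>lebesgue\<close> directly. It is transferred from a Borel function
  that agrees with \<open>h\<close> almost everywhere; for almost every \<open>x\<close> the sections also agree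
  almost everywhere.
\<close>

lemma lebesgue_Fubini_integrable:
  fixes h :: "'a::euclidean_space \<times> 'b::euclidean_space \<Rightarrow> complex"
  assumes "integrable lebesgue h"
  shows "AE x in lebesgue. integrable lebesgue (\<lambda>y. h (x, y))"
    and "integrable lebesgue (\<lambda>x. integral\<^sup>L lebesgue (\<lambda>y. h (x, y)))"
proof -
  obtain g where g: "g \<in> borel_measurable lborel" and hg: "AE z in lborel. h z = g z"
    using lebesgue_ex_borel_AE_eq assms borel_measurable_integrable by blast
  have "integrable lebesgue g"
    using assms measurable_completion[OF g] AE_completion[OF hg] by (rule integrable_cong_AE_imp)
  then have gi: "integrable (lborel \<Otimes>\<^sub>M lborel) g"
    using g by (simp add: integrable_completion lborel_prod)
  have "AE x in lborel. AE y in lborel. h (x, y) = g (x, y)"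
    by (intro lborel_pair.AE_pair) (unfold lborel_prod, rule hg)
  moreover have "AE x in lborel. integrable lborel (\<lambda>y. g (x, y))"
    by (rule lborel_pair.AE_integrable_fst'[OF gi])
  ultimately have 1: "AE x in lborel. integrable lebesgue (\<lambda>y. h (x, y)) \<and>
      integral\<^sup>L lebesgue (\<lambda>y. h (x, y)) = integral\<^sup>L lborel (\<lambda>y. g (x, y))"
  proof eventually_elim
    case (elim x)
    have "integrable lebesgue (\<lambda>y. h (x, y))"
      by (rule integrable_AE_eq_lebesgue[OF elim(2,1)])
    moreover have "integral\<^sup>L lebesgue (\<lambda>y. h (x, y)) = integral\<^sup>L lebesgue (\<lambda>y. g (x, y))"
      using calculation elim
      by (intro integral_cong_AE AE_completion) (auto intro: borel_measurable_integrable measurable_completion)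
    ultimately show ?case
      using elim by (simp add: integral_completion borel_measurable_integrable)
  qed
  then show "AE x in lebesgue. integrable lebesgue (\<lambda>y. h (x, y))"
    by (intro AE_completion) auto
  show "integrable lebesgue (\<lambda>x. integral\<^sup>L lebesgue (\<lambda>y. h (x, y)))"
    by (rule integrable_AE_eq_lebesgue[OF lborel_pair.integrable_fst'[OF gi]]) (use 1 in auto)
qed

lemma lebesgue_on_Fubini_integrable:
  fixes h :: "'a::euclidean_space \<times> 'b::euclidean_space \<Rightarrow> complex"
  assumes S: "open S" and T: "open T" and h: "integrable (lebesgue_on (S \<times> T)) h"
  shows "AE x in lebesgue_on S. integrable (lebesgue_on T) (\<lambda>y. h (x, y))"
    and "integrable (lebesgue_on S) (\<lambda>x. integral\<^sup>L (lebesgue_on T) (\<lambda>y. h (x, y)))"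
proof -
  let ?h = "\<lambda>z. indicat_real (S \<times> T) z *\<^sub>R h z"
  have sets: "S \<in> sets lebesgue" "T \<in> sets lebesgue" "S \<times> T \<in> sets lebesgue"
    using S T by (auto simp: open_Times)
  have "integrable lebesgue ?h"
    using h sets(3) by (simp add: integrable_restrict_space)
  note Fubini = lebesgue_Fubini_integrable[OF this]
  have slice: "?h (x, y) = indicat_real S x *\<^sub>R (indicat_real T y *\<^sub>R h (x, y))" for x y
    by (auto simp: indicator_def)
  from Fubini(1) show "AE x in lebesgue_on S. integrable (lebesgue_on T) (\<lambda>y. h (x, y))"
    using sets unfolding slice
    by (auto simp: AE_restrict_space_iff integrable_restrict_space elim!: AE_mp)
  from Fubini(2) show "integrable (lebesgue_on S) (\<lambda>x. integral\<^sup>L (lebesgue_on T) (\<lambda>y. h (x, y)))"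
    using sets unfolding slice by (simp add: integrable_restrict_space integral_restrict_space del: scaleR_scaleR)
qed

text \<open>
  Integrability on the product domain is what makes additivity valid: the inner integrals may
  fail to exist on a null set of \<open>x\<close>.
\<close>

lemma iterated_integral_add:
  assumes "open \<Omega>"
    and g: "integrable (lebesgue_on (\<Omega> \<times> ball 0 1)) g" and h: "integrable (lebesgue_on (\<Omega> \<times> ball 0 1)) h"
  shows "iterated_integral \<Omega> (\<lambda>z. g z + h z) = iterated_integral \<Omega> g + iterated_integral \<Omega> h"
proof -
  let ?I = "\<lambda>f x. integral\<^sup>L (lebesgue_on (ball 0 1)) (\<lambda>u. f (x, u))"
  note G = lebesgue_on_Fubini_integrable[OF assms(1) open_ball g]
  note H = lebesgue_on_Fubini_integrable[OF assms(1) open_ball h]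
  have "integrable (lebesgue_on (\<Omega> \<times> ball 0 1)) (\<lambda>z. g z + h z)"
    using g h by (rule Bochner_Integration.integrable_add)
  note GH = lebesgue_on_Fubini_integrable[OF assms(1) open_ball this]
  have "AE x in lebesgue_on \<Omega>. ?I (\<lambda>z. g z + h z) x = ?I g x + ?I h x"
    using G(1) H(1) by eventually_elim (rule Bochner_Integration.integral_add)
  then have "iterated_integral \<Omega> (\<lambda>z. g z + h z) = (\<integral>x. ?I g x + ?I h x \<partial>lebesgue_on \<Omega>)"
    unfolding iterated_integral_def using G(2) H(2) GH(2)
    by (intro integral_cong_AE) (auto intro: borel_measurable_integrable)
  then show ?thesis
    unfolding iterated_integral_def using G(2) H(2) by simp
qed

lemma L2_integrable_mult:
  assumes "f \<in> L2 S" "g \<in> L2 S"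
  shows "integrable (lebesgue_on S) (\<lambda>z. f z * g z)"
proof (rule Bochner_Integration.integrable_bound)
  show "integrable (lebesgue_on S) (\<lambda>z. (cmod (f z))\<^sup>2 + (cmod (g z))\<^sup>2)"
    using assms by (auto simp: L2_def)
  show "(\<lambda>z. f z * g z) \<in> borel_measurable (lebesgue_on S)"
    using assms by (auto simp: L2_def)
  have "a * b \<le> a\<^sup>2 + b\<^sup>2" if "0 \<le> a" "0 \<le> b" for a b :: real
    using sum_squares_bound[of a b] mult_nonneg_nonneg[OF that] by linarith
  then show "AE z in lebesgue_on S. cmod (f z * g z) \<le> norm ((cmod (f z))\<^sup>2 + (cmod (g z))\<^sup>2)"
    by (simp add: norm_mult)
qed

lemma L2_diff:
  assumes "f \<in> L2 S" "g \<in> L2 S"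
  shows "(\<lambda>z. f z - g z) \<in> L2 S"
  unfolding L2_def
proof (intro CollectI conjI)
  show [measurable]: "(\<lambda>z. f z - g z) \<in> borel_measurable (lebesgue_on S)"
    using assms by (auto simp: L2_def)
  show "integrable (lebesgue_on S) (\<lambda>z. (cmod (f z - g z))\<^sup>2)"
  proof (rule Bochner_Integration.integrable_bound)
    show "integrable (lebesgue_on S) (\<lambda>z. 2 * (cmod (f z))\<^sup>2 + 2 * (cmod (g z))\<^sup>2)"
      using assms by (auto simp: L2_def)
    have "(cmod (a - b))\<^sup>2 \<le> 2 * (cmod a)\<^sup>2 + 2 * (cmod b)\<^sup>2" for a b
    proof -
      have "(cmod (a - b))\<^sup>2 \<le> (cmod a + cmod b)\<^sup>2"
        by (intro power_mono norm_triangle_ineq4) simp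
      also have "\<dots> \<le> 2 * (cmod a)\<^sup>2 + 2 * (cmod b)\<^sup>2"
        using sum_squares_bound[of "cmod a" "cmod b"] by (simp add: power2_sum)
      finally show ?thesis .
    qed
    then show "AE z in lebesgue_on S. norm ((cmod (f z - g z))\<^sup>2) \<le> norm (2 * (cmod (f z))\<^sup>2 + 2 * (cmod (g z))\<^sup>2)"
      by simp
  qed measurable
qed

lemma iterated_integral_cnj: "iterated_integral \<Omega> (\<lambda>z. cnj (h z)) = cnj (iterated_integral \<Omega> h)"
  by (simp add: iterated_integral_def)

section \<open>The projection as an integral operator\<close>

theorem proposition4p4:
  fixes \<Omega> :: "(real^'m) set"
    and k :: nat
    and R :: "real^'m \<Rightarrow> real^'m \<Rightarrow> real^'m \<Rightarrow> real^'m \<Rightarrow> complex"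
    and B :: "((real^'m) \<times> (real^'m) \<Rightarrow> complex) \<Rightarrow> (real^'m) \<times> (real^'m) \<Rightarrow> complex"
    and x v :: "real^'m"
  assumes "CARD('m) \<ge> 3" and "k \<ge> 1"
    and "open \<Omega>" and "connected \<Omega>" and "bounded \<Omega>"
    and "is_reproducing_kernel k \<Omega> R"
    and "is_bergman_projection k \<Omega> B"
    and "x \<in> \<Omega>" and "v \<in> ball 0 1"
  shows "\<forall>f \<in> L2 (\<Omega> \<times> ball 0 1).
    B f (x, v) =
      integral\<^sup>L (lebesgue_on \<Omega>)
        (\<lambda>y. integral\<^sup>L (lebesgue_on (ball 0 1)) (\<lambda>u. R y x u v * f (y, u)))"
proof
  fix f :: "(real^'m) \<times> (real^'m) \<Rightarrow> complex"
  assume f: "f \<in> L2 (\<Omega> \<times> ball 0 1)"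
  define r where "r = (\<lambda>(y, u). R y x u v)"
  have r: "r \<in> bosonic_bergman k \<Omega>"
    and repr: "\<And>g. g \<in> bosonic_bergman k \<Omega> \<Longrightarrow> g (x, v) = b2_inner \<Omega> r g"
    using assms(6,8,9) unfolding is_reproducing_kernel_def r_def by blast+
  have Bf: "B f \<in> bosonic_bergman k \<Omega>"
    and orth: "\<And>g. g \<in> bosonic_bergman k \<Omega> \<Longrightarrow> b2_inner \<Omega> g (\<lambda>z. f z - B f z) = 0"
    using assms(7) f unfolding is_bergman_projection_def by blast+
  have L2: "g \<in> L2 (\<Omega> \<times> ball 0 1)" if "g \<in> bosonic_bergman k \<Omega>" for g
    using that by (simp add: bosonic_bergman_def)
  have "cnj (B f (x, v)) = iterated_integral \<Omega> (\<lambda>z. cnj (r z * B f z))"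
    using repr[OF cnj_bosonic_bergman[OF assms(3) Bf]] by (simp add: b2_inner_def)
  then have reproduced: "B f (x, v) = iterated_integral \<Omega> (\<lambda>z. r z * B f z)"
    by (simp only: iterated_integral_cnj complex_cnj_cancel_iff)
  have orthogonal: "iterated_integral \<Omega> (\<lambda>z. r z * (f z - B f z)) = 0"
    using orth[OF cnj_bosonic_bergman[OF assms(3) r]] by (simp add: b2_inner_def)
  have "iterated_integral \<Omega> (\<lambda>z. r z * f z)
      = iterated_integral \<Omega> (\<lambda>z. r z * (f z - B f z) + r z * B f z)"
    by (simp add: algebra_simps)
  also have "\<dots> = iterated_integral \<Omega> (\<lambda>z. r z * (f z - B f z)) + iterated_integral \<Omega> (\<lambda>z. r z * B f z)"
    by (intro iterated_integral_add assms(3) L2_integrable_mult L2_diff f L2 r Bf)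
  also have "\<dots> = B f (x, v)"
    by (simp add: orthogonal reproduced)
  finally show "B f (x, v) =
      integral\<^sup>L (lebesgue_on \<Omega>)
        (\<lambda>y. integral\<^sup>L (lebesgue_on (ball 0 1)) (\<lambda>u. R y x u v * f (y, u)))"
    by (simp add: iterated_integral_def r_def)
qed

end
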